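(* Let $(\Omega,\Sigma)$ be a measurable space and suppose there is an uncountable set $\Omega_0\subseteq\Omega$ such that $\{t\}\in\Sigma$ for every $t\in\Omega_0$. Fix an injective map $i:\omega_1\to\Omega_0$ and define $M:\Sigma\to b(c_0(\omega_1))$ by $$M(A):=\left\{\sum_{\alpha\in F}e_\alpha-\sum_{\alpha\in G}e_\alpha:\ F,G\subseteq i^{-1}(A)\text{ are finite and disjoint}\right\}$$ for every $A\in\Sigma$. Then $M$ is a multimeasure not admitting a control measure.
   Context: $\omega_1$ is the first uncountable ordinal (identified with the set of ordinals $\alpha<\omega_1$), and $c_0(\omega_1)$ is the real Banach space with the supremum norm; $e_\alpha\in c_0(\omega_1)$ is defined by $e_\alpha(\alpha)=1$ and $e_\alpha(\beta)=0$ for $\beta\neq\alpha$. For a real Banach space $X$, $b(X)$ is the family of all bounded non-empty subsets of $X$. For $C\in b(X)$ and $x^*\in X^*$, $s(x^*,C):=\sup\{x^*(x): x\in C\}$. ${\rm ca}(\Sigma)$ is the set of all countably additive real-valued (signed, finite) measures on $\Sigma$, and ${\rm ca}^+(\Sigma)$ is the subset of finite non-negative measures. A map $M:\Sigma\to b(X)$ is a multimeasure if for each $x^*\in X^*$ the map $A\mapsto s(x^*,M(A))$ belongs to ${\rm ca}(\Sigma)$. A measure $\mu\in{\rm ca}^+(\Sigma)$ is a control measure of $M$ if $M(A)=\{0\}$ for every $A\in\Sigma$ with $\mu(A)=0$. *)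

theory Defs
  imports "HOL-Analysis.Analysis" "HOL-Library.Countable_Set_Type"
begin

section \<open>The first uncountable ordinal\<close>

text \<open>\<open>cardSuc natLeq\<close> is a well-order of minimal length among those of
  cardinality greater than the naturals, i.e. a well-order of type \<open>\<omega>\<^sub>1\<close>.
  The type \<open>omega1\<close> is its field, with the induced order; the lemmas
  \<open>uncountable_omega1\<close> and \<open>countable_lessThan_omega1\<close> characterise it
  up to order isomorphism.\<close>

typedef omega1 = "Field (cardSuc natLeq)"
  morphisms rep_omega1 Abs_omega1
  using Field_cardSuc_not_empty[OF natLeq_Card_order] by blast

lemma Well_order_cardSuc_natLeq: "Well_order (cardSuc natLeq)"
  using cardSuc_Card_order[OF natLeq_Card_order] by (rule Card_order_wo_rel[unfolded wo_rel_def])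

instantiation omega1 :: wellorder
begin

definition less_eq_omega1 :: "omega1 \<Rightarrow> omega1 \<Rightarrow> bool" where
  "a \<le> b \<longleftrightarrow> (rep_omega1 a, rep_omega1 b) \<in> cardSuc natLeq"

definition less_omega1 :: "omega1 \<Rightarrow> omega1 \<Rightarrow> bool" where
  "a < b \<longleftrightarrow> a \<le> b \<and> a \<noteq> b" for a b :: omega1

instance
proof
  have lin: "Linear_order (cardSuc natLeq)" and wf: "wf (cardSuc natLeq - Id)"
    using Well_order_cardSuc_natLeq by (auto simp: well_order_on_def)
  have refl: "refl_on (Field (cardSuc natLeq)) (cardSuc natLeq)"
    and tr: "trans (cardSuc natLeq)" and asym: "antisym (cardSuc natLeq)"
    and tot: "total_on (Field (cardSuc natLeq)) (cardSuc natLeq)"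
    using lin by (auto simp: linear_order_on_def partial_order_on_def preorder_on_def)
  fix a b c :: omega1
  show r: "a \<le> a" for a :: omega1
    using refl rep_omega1[of a] by (auto simp: less_eq_omega1_def refl_on_def)
  show as: "a \<le> b \<Longrightarrow> b \<le> a \<Longrightarrow> a = b" for a b :: omega1
    using asym unfolding less_eq_omega1_def by (metis antisymD rep_omega1_inject)
  show "a < b \<longleftrightarrow> a \<le> b \<and> \<not> b \<le> a"
    using as[of a b] r by (auto simp: less_omega1_def)
  show "a \<le> b \<Longrightarrow> b \<le> c \<Longrightarrow> a \<le> c"
    using tr unfolding less_eq_omega1_def by (blast dest: transD)
  show "a \<le> b \<or> b \<le> a"
    using tot rep_omega1[of a] rep_omega1[of b] r[of a]
    unfolding less_eq_omega1_def total_on_def by (metis rep_omega1_inject)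
  fix P :: "omega1 \<Rightarrow> bool" and x
  assume step: "\<And>x. (\<And>y. y < x \<Longrightarrow> P y) \<Longrightarrow> P x"
  have "wf (inv_image (cardSuc natLeq - Id) rep_omega1)"
    using wf by (rule wf_inv_image)
  then have "wf {(x, y::omega1). x < y}"
    by (simp add: inv_image_def less_omega1_def less_eq_omega1_def rep_omega1_inject)
  then show "P x"
    by (induction x rule: wf_induct_rule) (auto intro: step)
qed

end

context
  includes cardinal_syntax
begin

lemma uncountable_omega1: "uncountable (UNIV :: omega1 set)"
proof
  assume "countable (UNIV :: omega1 set)"
  then have "countable (range rep_omega1)"
    by (rule countable_image)
  then have "countable (Field (cardSuc natLeq))"
    using type_definition.Rep_range[OF type_definition_omega1] by simp
  then have "|Field (cardSuc natLeq)| \<le>o natLeq"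
    by (simp add: countable_card_le_natLeq)
  then have "cardSuc natLeq \<le>o natLeq"
    by (meson card_of_Field_ordIso cardSuc_Card_order natLeq_Card_order
        ordIso_ordLeq_trans ordIso_symmetric)
  then show False
    using cardSuc_greater[OF natLeq_Card_order] not_ordLess_ordLeq by blast
qed

lemma countable_lessThan_omega1: "countable {..<a}" for a :: omega1
proof -
  have "|underS (cardSuc natLeq) (rep_omega1 a)| <o cardSuc natLeq"
    using card_of_underS[OF cardSuc_Card_order[OF natLeq_Card_order]] rep_omega1 by blast
  then have "countable (underS (cardSuc natLeq) (rep_omega1 a))"
    using cardSuc_ordLeq_ordLess[OF natLeq_Card_order card_of_Card_order]
    unfolding countable_card_le_natLeq by blast
  moreover have "rep_omega1 ` {..<a} \<subseteq> underS (cardSuc natLeq) (rep_omega1 a)"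
    by (auto simp: underS_def less_omega1_def less_eq_omega1_def rep_omega1_inject)
  moreover have "inj_on rep_omega1 {..<a}"
    by (simp add: inj_on_def rep_omega1_inject)
  ultimately show ?thesis
    by (meson countable_image_inj_on countable_subset)
qed

end


section \<open>The Banach space \<open>c\<^sub>0(I)\<close> with the supremum norm\<close>

typedef 'i c0 = "{x :: 'i \<Rightarrow> real. \<forall>\<epsilon>>0. finite {i. \<epsilon> \<le> \<bar>x i\<bar>}}"
  morphisms c0_apply Abs_c0
  by (rule exI[of _ "\<lambda>_. 0"]) auto

lemma c0_eqI: "(\<And>i. c0_apply x i = c0_apply y i) \<Longrightarrow> x = y"
  by (simp add: c0_apply_inject[symmetric] fun_eq_iff)

lemma finite_c0_apply: "\<epsilon> > 0 \<Longrightarrow> finite {i. \<epsilon> \<le> \<bar>c0_apply x i\<bar>}"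
  using c0_apply[of x] by auto

lemma c0_bdd_above: "bdd_above (range (\<lambda>i. \<bar>c0_apply x i\<bar>))"
proof -
  have "bdd_above ((\<lambda>i. \<bar>c0_apply x i\<bar>) ` {i. 1 \<le> \<bar>c0_apply x i\<bar>})"
    using finite_c0_apply[of 1 x] by (intro bdd_above_finite) auto
  moreover have "bdd_above ((\<lambda>i. \<bar>c0_apply x i\<bar>) ` {i. \<not> 1 \<le> \<bar>c0_apply x i\<bar>})"
    by (rule bdd_aboveI2[of _ _ 1]) auto
  ultimately have "bdd_above ((\<lambda>i. \<bar>c0_apply x i\<bar>) `
      ({i. 1 \<le> \<bar>c0_apply x i\<bar>} \<union> {i. \<not> 1 \<le> \<bar>c0_apply x i\<bar>}))"
    by (simp only: image_Un bdd_above_Un)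
  moreover have "{i. 1 \<le> \<bar>c0_apply x i\<bar>} \<union> {i. \<not> 1 \<le> \<bar>c0_apply x i\<bar>} = UNIV"
    by blast
  ultimately show ?thesis
    by simp
qed

lemma c0_scale_add_mem:
  "(\<lambda>i. r * c0_apply x i + s * c0_apply y i) \<in> {x. \<forall>\<epsilon>>0. finite {i. \<epsilon> \<le> \<bar>x i\<bar>}}"
proof safe
  fix \<epsilon> :: real assume e: "\<epsilon> > 0"
  define d where "d = \<epsilon> / (2 * (1 + \<bar>r\<bar> + \<bar>s\<bar>))"
  have d: "d > 0"
    using e by (simp add: d_def add_pos_nonneg)
  have "{i. \<epsilon> \<le> \<bar>r * c0_apply x i + s * c0_apply y i\<bar>}
      \<subseteq> {i. d \<le> \<bar>c0_apply x i\<bar>} \<union> {i. d \<le> \<bar>c0_apply y i\<bar>}"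
  proof safe
    fix i assume i: "\<epsilon> \<le> \<bar>r * c0_apply x i + s * c0_apply y i\<bar>"
      and n: "\<not> d \<le> \<bar>c0_apply y i\<bar>"
    show "d \<le> \<bar>c0_apply x i\<bar>"
    proof (rule ccontr)
      assume m: "\<not> d \<le> \<bar>c0_apply x i\<bar>"
      have "\<bar>r * c0_apply x i + s * c0_apply y i\<bar> \<le> \<bar>r\<bar> * \<bar>c0_apply x i\<bar> + \<bar>s\<bar> * \<bar>c0_apply y i\<bar>"
        by (metis abs_mult abs_triangle_ineq)
      also have "\<dots> \<le> \<bar>r\<bar> * d + \<bar>s\<bar> * d"
        using m n by (intro add_mono mult_left_mono) auto
      also have "\<dots> \<le> (1 + \<bar>r\<bar> + \<bar>s\<bar>) * d"
        using d by (simp add: algebra_simps)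
      also have "\<dots> = \<epsilon> / 2"
        by (simp add: d_def add_nonneg_eq_0_iff field_simps add_pos_nonneg less_imp_neq[symmetric])
      finally show False
        using i e by simp
    qed
  qed
  then show "finite {i. \<epsilon> \<le> \<bar>r * c0_apply x i + s * c0_apply y i\<bar>}"
    by (rule finite_subset) (simp add: finite_c0_apply[OF d])
qed

instantiation c0 :: (type) real_vector
begin

definition "0 = Abs_c0 (\<lambda>_. 0)"
definition "x + y = Abs_c0 (\<lambda>i. c0_apply x i + c0_apply y i)"
definition "x - y = Abs_c0 (\<lambda>i. c0_apply x i - c0_apply y i)"
definition "- x = Abs_c0 (\<lambda>i. - c0_apply x i)"
definition "r *\<^sub>R x = Abs_c0 (\<lambda>i. r * c0_apply x i)"

lemma c0_apply_zero [simp]: "c0_apply 0 i = 0"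
  by (simp add: zero_c0_def Abs_c0_inverse)

lemma c0_apply_add [simp]: "c0_apply (x + y) i = c0_apply x i + c0_apply y i"
  using c0_scale_add_mem[of 1 x 1 y] by (simp add: plus_c0_def Abs_c0_inverse)

lemma c0_apply_diff [simp]: "c0_apply (x - y) i = c0_apply x i - c0_apply y i"
  using c0_scale_add_mem[of 1 x "-1" y] by (simp add: minus_c0_def Abs_c0_inverse)

lemma c0_apply_uminus [simp]: "c0_apply (- x) i = - c0_apply x i"
  using c0_scale_add_mem[of "-1" x 0 x] by (simp add: uminus_c0_def Abs_c0_inverse)

lemma c0_apply_scaleR [simp]: "c0_apply (r *\<^sub>R x) i = r * c0_apply x i"
  using c0_scale_add_mem[of r x 0 x] by (simp add: scaleR_c0_def Abs_c0_inverse)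

instance
  by standard (auto intro!: c0_eqI simp: algebra_simps)

end

instantiation c0 :: (type) real_normed_vector
begin

definition "norm x = (SUP i. \<bar>c0_apply x i\<bar>)"
definition "dist x y = norm (x - y)" for x y :: "'a c0"
definition "sgn x = inverse (norm x) *\<^sub>R x" for x :: "'a c0"
definition "uniformity = (INF e\<in>{0<..}. principal {(x, y::'a c0). dist x y < e})"
definition "open U = (\<forall>x\<in>U. \<forall>\<^sub>F (x', y) in uniformity. x' = x \<longrightarrow> y \<in> U)" for U :: "'a c0 set"

lemma c0_apply_le_norm: "\<bar>c0_apply x i\<bar> \<le> norm x"
  unfolding norm_c0_def by (rule cSUP_upper[OF _ c0_bdd_above]) simp

lemma c0_norm_le: "(\<And>i. \<bar>c0_apply x i\<bar> \<le> b) \<Longrightarrow> norm x \<le> b"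
  unfolding norm_c0_def by (rule cSUP_least) auto

instance
proof
  fix x y :: "'a c0" and r :: real
  have nonneg: "0 \<le> norm x" for x :: "'a c0"
    using c0_apply_le_norm[of x undefined] by linarith
  show "norm x = 0 \<longleftrightarrow> x = 0"
  proof
    assume "norm x = 0"
    then show "x = 0"
      using c0_apply_le_norm[of x] by (intro c0_eqI) simp
  next
    assume "x = 0"
    then show "norm x = 0"
      using nonneg[of x] c0_norm_le[of x 0] by simp
  qed
  show "norm (x + y) \<le> norm x + norm y"
    by (rule c0_norm_le) (smt (verit) c0_apply_add c0_apply_le_norm)
  have le: "norm (r *\<^sub>R x) \<le> \<bar>r\<bar> * norm x" for r and x :: "'a c0"
    by (rule c0_norm_le) (simp add: abs_mult mult_left_mono c0_apply_le_norm)
  show "norm (r *\<^sub>R x) = \<bar>r\<bar> * norm x"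
  proof (cases "r = 0")
    case True
    then show ?thesis
      using le[of r x] nonneg[of "r *\<^sub>R x"] by simp
  next
    case False
    have "\<bar>r\<bar> * norm x = \<bar>r\<bar> * norm (inverse r *\<^sub>R (r *\<^sub>R x))"
      using False by simp
    also have "\<dots> \<le> \<bar>r\<bar> * (\<bar>inverse r\<bar> * norm (r *\<^sub>R x))"
      by (intro mult_left_mono le) simp
    also have "\<dots> = norm (r *\<^sub>R x)"
      using False by (simp add: field_simps)
    finally show ?thesis
      using le[of r x] by simp
  qed
qed (simp_all add: dist_c0_def sgn_c0_def uniformity_c0_def open_c0_def)

end

instance c0 :: (type) banach
proof
  fix X :: "nat \<Rightarrow> 'a c0"
  assume C: "Cauchy X"
  have unif: "\<exists>N. \<forall>m\<ge>N. \<forall>n\<ge>N. \<forall>i. \<bar>c0_apply (X m) i - c0_apply (X n) i\<bar> < \<epsilon>" if e: "\<epsilon> > 0" for \<epsilon> :: real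
  proof -
    obtain N where "\<forall>m\<ge>N. \<forall>n\<ge>N. norm (X m - X n) < \<epsilon>"
      using C[unfolded Cauchy_iff] e by blast
    then show ?thesis
      by (intro exI[of _ N]) (metis c0_apply_diff c0_apply_le_norm order_le_less_trans)
  qed
  have "convergent (\<lambda>n. c0_apply (X n) i)" for i
    using unif by (intro Cauchy_convergent) (metis Cauchy_iff real_norm_def)
  then obtain l where l: "\<And>i. (\<lambda>n. c0_apply (X n) i) \<longlonglongrightarrow> l i"
    unfolding convergent_def by metis
  have lim: "\<exists>N. \<forall>m\<ge>N. \<forall>i. \<bar>c0_apply (X m) i - l i\<bar> \<le> \<epsilon>" if e: "\<epsilon> > 0" for \<epsilon>
  proof -
    obtain N where N: "\<forall>m\<ge>N. \<forall>n\<ge>N. \<forall>i. \<bar>c0_apply (X m) i - c0_apply (X n) i\<bar> < \<epsilon>"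
      using unif[OF e] by blast
    have "\<bar>c0_apply (X m) i - l i\<bar> \<le> \<epsilon>" if "m \<ge> N" for m i
    proof (rule LIMSEQ_le_const2)
      show "(\<lambda>n. \<bar>c0_apply (X m) i - c0_apply (X n) i\<bar>) \<longlonglongrightarrow> \<bar>c0_apply (X m) i - l i\<bar>"
        by (intro tendsto_intros l)
      show "\<exists>N. \<forall>n\<ge>N. \<bar>c0_apply (X m) i - c0_apply (X n) i\<bar> \<le> \<epsilon>"
        using N that by (intro exI[of _ N]) (auto intro: less_imp_le)
    qed
    then show ?thesis
      by blast
  qed
  have "finite {i. \<epsilon> \<le> \<bar>l i\<bar>}" if e: "\<epsilon> > 0" for \<epsilon>
  proof -
    obtain m where m: "\<And>i. \<bar>c0_apply (X m) i - l i\<bar> \<le> \<epsilon> / 2"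
      using lim[of "\<epsilon> / 2"] e by auto
    have "\<epsilon> / 2 \<le> \<bar>c0_apply (X m) i\<bar>" if "\<epsilon> \<le> \<bar>l i\<bar>" for i
      using m[of i] that by (simp add: abs_if split: if_splits)
    then have "{i. \<epsilon> \<le> \<bar>l i\<bar>} \<subseteq> {i. \<epsilon> / 2 \<le> \<bar>c0_apply (X m) i\<bar>}"
      by blast
    then show ?thesis
      by (rule finite_subset) (rule finite_c0_apply[OF half_gt_zero[OF e]])
  qed
  then have app: "c0_apply (Abs_c0 l) = l"
    by (simp add: Abs_c0_inverse)
  have "X \<longlonglongrightarrow> Abs_c0 l"
  proof (rule LIMSEQ_I)
    fix \<epsilon> :: real assume e: "\<epsilon> > 0"
    then obtain N where N: "\<forall>m\<ge>N. \<forall>i. \<bar>c0_apply (X m) i - l i\<bar> \<le> \<epsilon> / 2"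
      using lim[of "\<epsilon> / 2"] by auto
    have "norm (X m - Abs_c0 l) < \<epsilon>" if "m \<ge> N" for m
    proof -
      have "norm (X m - Abs_c0 l) \<le> \<epsilon> / 2"
        using N that by (intro c0_norm_le) (simp add: app)
      then show ?thesis
        using e by simp
    qed
    then show "\<exists>N. \<forall>m\<ge>N. norm (X m - Abs_c0 l) < \<epsilon>"
      by blast
  qed
  then show "convergent X"
    by (rule convergentI)
qed

definition c0_unit :: "'i \<Rightarrow> 'i c0" where
  "c0_unit \<alpha> = Abs_c0 (\<lambda>\<beta>. if \<beta> = \<alpha> then 1 else 0)"

lemma c0_apply_unit [simp]: "c0_apply (c0_unit \<alpha>) \<beta> = (if \<beta> = \<alpha> then 1 else 0)"
proof -
  have "finite {\<beta>. \<epsilon> \<le> \<bar>if \<beta> = \<alpha> then 1 else 0 :: real\<bar>}" if e: "\<epsilon> > 0" for \<epsilon> :: real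
  proof (rule finite_subset)
    show "{\<beta>. \<epsilon> \<le> \<bar>if \<beta> = \<alpha> then 1 else 0 :: real\<bar>} \<subseteq> {\<alpha>}"
      using e by (simp add: subset_iff)
  qed simp
  then show ?thesis
    by (simp add: c0_unit_def Abs_c0_inverse)
qed


section \<open>Multimeasures\<close>

definition bdd_nonempty :: "'x::banach set set" where
  "bdd_nonempty = {C. bounded C \<and> C \<noteq> {}}"

definition support_fun :: "('x::banach \<Rightarrow>\<^sub>L real) \<Rightarrow> 'x set \<Rightarrow> real" where
  "support_fun f C = (SUP x\<in>C. blinfun_apply f x)"

text \<open>Set functions are total in HOL; only their values on \<open>\<Sigma>\<close> are constrained below.
  The constant sequence of empty sets shows that \<open>\<nu> \<in> ca \<Sigma>\<close> forces \<open>\<nu> {} = 0\<close>.\<close>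

definition ca :: "'w set set \<Rightarrow> ('w set \<Rightarrow> real) set" where
  "ca \<Sigma> = {\<nu>. \<forall>A :: nat \<Rightarrow> 'w set. range A \<subseteq> \<Sigma> \<longrightarrow> disjoint_family A \<longrightarrow>
      (\<lambda>n. \<nu> (A n)) sums \<nu> (\<Union>n. A n)}"

definition ca_plus :: "'w set set \<Rightarrow> ('w set \<Rightarrow> real) set" where
  "ca_plus \<Sigma> = {\<mu> \<in> ca \<Sigma>. \<forall>A\<in>\<Sigma>. 0 \<le> \<mu> A}"

definition multimeasure :: "'w set set \<Rightarrow> ('w set \<Rightarrow> 'x::banach set) \<Rightarrow> bool" where
  "multimeasure \<Sigma> M \<longleftrightarrow>
    M \<in> \<Sigma> \<rightarrow> bdd_nonempty \<and>
    (\<forall>f :: 'x \<Rightarrow>\<^sub>L real. (\<lambda>A. support_fun f (M A)) \<in> ca \<Sigma>)"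

definition control_measure ::
    "'w set set \<Rightarrow> ('w set \<Rightarrow> 'x::banach set) \<Rightarrow> ('w set \<Rightarrow> real) \<Rightarrow> bool" where
  "control_measure \<Sigma> M \<mu> \<longleftrightarrow> \<mu> \<in> ca_plus \<Sigma> \<and> (\<forall>A\<in>\<Sigma>. \<mu> A = 0 \<longrightarrow> M A = {0})"

end

theory Submission
  imports Defs
begin

text \<open>Choosing signs, the support function of \<open>M A\<close> at \<open>f\<close> is the sum of \<open>\<bar>f e\<^sub>\<alpha>\<bar>\<close> over
  \<open>\<alpha> \<in> i\<^sup>-\<^sup>1(A)\<close>. Since finite sums \<open>\<Sum>\<plusminus>e\<^sub>\<alpha>\<close> lie in the unit ball, this family is summable, and
  countable additivity is that of unconditional sums. A control measure would have to charge
  each of the uncountably many singletons \<open>{i \<alpha>}\<close>, which a finite measure cannot do.\<close>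

definition signed_unit_sums :: "'i set \<Rightarrow> 'i c0 set" where
  "signed_unit_sums B = {(\<Sum>\<alpha>\<in>F. c0_unit \<alpha>) - (\<Sum>\<alpha>\<in>G. c0_unit \<alpha>) | F G.
     F \<subseteq> B \<and> G \<subseteq> B \<and> finite F \<and> finite G \<and> F \<inter> G = {}}"

lemma c0_apply_sum: "c0_apply (sum x F) \<beta> = (\<Sum>\<alpha>\<in>F. c0_apply (x \<alpha>) \<beta>)"
  by (induction F rule: infinite_finite_induct) auto

text \<open>Each coordinate is a difference of two indicator values, so it is -1, 0 or 1. The bound
  in the supremum norm is thus independent of the number of terms.\<close>

lemma norm_signed_unit_sums_le:
  assumes "x \<in> signed_unit_sums B"
  shows "norm x \<le> 1"
proof -
  obtain F G where "finite F" "finite G" "F \<inter> G = {}"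
    and "x = (\<Sum>\<alpha>\<in>F. c0_unit \<alpha>) - (\<Sum>\<alpha>\<in>G. c0_unit \<alpha>)"
    using assms by (auto simp: signed_unit_sums_def)
  then show ?thesis
    by (intro c0_norm_le) (auto simp: c0_apply_sum)
qed

lemma zero_in_signed_unit_sums: "0 \<in> signed_unit_sums B"
  unfolding signed_unit_sums_def
  by (rule CollectI, rule exI[of _ "{}"], rule exI[of _ "{}"]) auto

lemma signed_unit_sums_bdd_nonempty: "signed_unit_sums B \<in> bdd_nonempty"
  using norm_signed_unit_sums_le zero_in_signed_unit_sums
  unfolding bdd_nonempty_def bounded_iff by blast

lemma c0_unit_in_signed_unit_sums:
  assumes "\<alpha> \<in> B"
  shows "c0_unit \<alpha> \<in> signed_unit_sums B"
  unfolding signed_unit_sums_def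
  by (rule CollectI, rule exI[of _ "{\<alpha>}"], rule exI[of _ "{}"]) (use assms in auto)

lemma c0_unit_neq_0: "c0_unit \<alpha> \<noteq> 0"
  by (metis c0_apply_unit c0_apply_zero zero_neq_one)

text \<open>Giving \<open>c0_unit \<alpha>\<close> the sign of its image under \<open>f\<close>
  turns every term into its absolute value. This serves both summability and the lower bound for the
  support function.\<close>

lemma sum_abs_attained:
  fixes f :: "'i c0 \<Rightarrow>\<^sub>L real"
  assumes "finite H" "H \<subseteq> B"
  obtains x where "x \<in> signed_unit_sums B"
    and "blinfun_apply f x = (\<Sum>\<alpha>\<in>H. \<bar>blinfun_apply f (c0_unit \<alpha>)\<bar>)"
proof
  let ?F = "{\<alpha>\<in>H. 0 \<le> blinfun_apply f (c0_unit \<alpha>)}"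
  let ?x = "(\<Sum>\<alpha>\<in>?F. c0_unit \<alpha>) - (\<Sum>\<alpha>\<in>H - ?F. c0_unit \<alpha>)"
  show "?x \<in> signed_unit_sums B"
    unfolding signed_unit_sums_def
    by (rule CollectI, rule exI[of _ ?F], rule exI[of _ "H - ?F"]) (use assms in auto)
  have "(\<Sum>\<alpha>\<in>H. \<bar>blinfun_apply f (c0_unit \<alpha>)\<bar>)
      = (\<Sum>\<alpha>\<in>?F. \<bar>blinfun_apply f (c0_unit \<alpha>)\<bar>) + (\<Sum>\<alpha>\<in>H - ?F. \<bar>blinfun_apply f (c0_unit \<alpha>)\<bar>)"
    using assms(1) by (subst sum.subset_diff[of ?F H]) auto
  also have "(\<Sum>\<alpha>\<in>?F. \<bar>blinfun_apply f (c0_unit \<alpha>)\<bar>) = (\<Sum>\<alpha>\<in>?F. blinfun_apply f (c0_unit \<alpha>))"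
    by (rule sum.cong) auto
  also have "(\<Sum>\<alpha>\<in>H - ?F. \<bar>blinfun_apply f (c0_unit \<alpha>)\<bar>) = - (\<Sum>\<alpha>\<in>H - ?F. blinfun_apply f (c0_unit \<alpha>))"
    unfolding sum_negf[symmetric] by (rule sum.cong) auto
  finally show "blinfun_apply f ?x = (\<Sum>\<alpha>\<in>H. \<bar>blinfun_apply f (c0_unit \<alpha>)\<bar>)"
    by (simp add: blinfun.diff_right blinfun.sum_right)
qed

lemma blinfun_le_norm_on_signed_unit_sums:
  fixes f :: "'i c0 \<Rightarrow>\<^sub>L real"
  assumes "x \<in> signed_unit_sums B"
  shows "blinfun_apply f x \<le> norm f"
proof -
  have "blinfun_apply f x \<le> norm f * norm x"
    using norm_blinfun[of f x] by simp
  also have "\<dots> \<le> norm f"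
    using norm_signed_unit_sums_le[OF assms] by (simp add: mult_left_le)
  finally show ?thesis .
qed

text \<open>Each finite partial sum is a value of \<open>f\<close> at a vector of the unit ball,
  hence at most \<open>norm f\<close>. This is the embedding of the dual of c_0 into l_1.\<close>

lemma blinfun_c0_unit_abs_summable:
  fixes f :: "'i c0 \<Rightarrow>\<^sub>L real"
  shows "(\<lambda>\<alpha>. \<bar>blinfun_apply f (c0_unit \<alpha>)\<bar>) summable_on B"
proof (rule nonneg_bdd_above_summable_on)
  show "bdd_above (sum (\<lambda>\<alpha>. \<bar>blinfun_apply f (c0_unit \<alpha>)\<bar>) ` {H. H \<subseteq> B \<and> finite H})"
  proof (rule bdd_aboveI2)
    fix H assume "H \<in> {H. H \<subseteq> B \<and> finite H}"
    then obtain x where "x \<in> signed_unit_sums B"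
      and "blinfun_apply f x = (\<Sum>\<alpha>\<in>H. \<bar>blinfun_apply f (c0_unit \<alpha>)\<bar>)"
      by (auto elim: sum_abs_attained)
    then show "(\<Sum>\<alpha>\<in>H. \<bar>blinfun_apply f (c0_unit \<alpha>)\<bar>) \<le> norm f"
      by (metis blinfun_le_norm_on_signed_unit_sums)
  qed
qed simp

lemma support_fun_signed_unit_sums:
  "support_fun f (signed_unit_sums B) = (\<Sum>\<^sub>\<infinity>\<alpha>\<in>B. \<bar>blinfun_apply f (c0_unit \<alpha>)\<bar>)"
  unfolding support_fun_def
proof (rule antisym)
  show "(SUP x\<in>signed_unit_sums B. blinfun_apply f x) \<le> (\<Sum>\<^sub>\<infinity>\<alpha>\<in>B. \<bar>blinfun_apply f (c0_unit \<alpha>)\<bar>)"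
  proof (rule cSUP_least)
    fix x assume "x \<in> signed_unit_sums B"
    then obtain F G where FG: "F \<subseteq> B" "G \<subseteq> B" "finite F" "finite G" "F \<inter> G = {}"
      and x: "x = (\<Sum>\<alpha>\<in>F. c0_unit \<alpha>) - (\<Sum>\<alpha>\<in>G. c0_unit \<alpha>)"
      by (auto simp: signed_unit_sums_def)
    have "blinfun_apply f x
        = (\<Sum>\<alpha>\<in>F. blinfun_apply f (c0_unit \<alpha>)) + (\<Sum>\<alpha>\<in>G. - blinfun_apply f (c0_unit \<alpha>))"
      by (simp add: x blinfun.diff_right blinfun.sum_right sum_negf)
    also have "\<dots> \<le> (\<Sum>\<alpha>\<in>F. \<bar>blinfun_apply f (c0_unit \<alpha>)\<bar>) + (\<Sum>\<alpha>\<in>G. \<bar>blinfun_apply f (c0_unit \<alpha>)\<bar>)"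
      by (intro add_mono sum_mono) auto
    \<comment> \<open>Disjointness of \<open>F\<close> and \<open>G\<close> merges the two sums into
      a single partial sum over a finite subset of \<open>B\<close>.\<close>
    also have "\<dots> = (\<Sum>\<alpha>\<in>F \<union> G. \<bar>blinfun_apply f (c0_unit \<alpha>)\<bar>)"
      using FG by (simp add: sum.union_disjoint)
    also have "\<dots> \<le> (\<Sum>\<^sub>\<infinity>\<alpha>\<in>B. \<bar>blinfun_apply f (c0_unit \<alpha>)\<bar>)"
      using FG by (intro finite_sum_le_infsum blinfun_c0_unit_abs_summable) auto
    finally show "blinfun_apply f x \<le> (\<Sum>\<^sub>\<infinity>\<alpha>\<in>B. \<bar>blinfun_apply f (c0_unit \<alpha>)\<bar>)" .
  qed (use zero_in_signed_unit_sums in blast)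
  show "(\<Sum>\<^sub>\<infinity>\<alpha>\<in>B. \<bar>blinfun_apply f (c0_unit \<alpha>)\<bar>) \<le> (SUP x\<in>signed_unit_sums B. blinfun_apply f x)"
  proof (rule infsum_le_finite_sums[OF blinfun_c0_unit_abs_summable])
    fix H assume "finite H" "H \<subseteq> B"
    then obtain x where "x \<in> signed_unit_sums B"
      and x: "blinfun_apply f x = (\<Sum>\<alpha>\<in>H. \<bar>blinfun_apply f (c0_unit \<alpha>)\<bar>)"
      by (rule sum_abs_attained)
    \<comment> \<open>A real \<open>SUP\<close> dominates the members of a set only when that set is
      bounded above.\<close>
    moreover have "bdd_above (blinfun_apply f ` signed_unit_sums B)"
      by (rule bdd_aboveI2) (rule blinfun_le_norm_on_signed_unit_sums)
    ultimately show "(\<Sum>\<alpha>\<in>H. \<bar>blinfun_apply f (c0_unit \<alpha>)\<bar>) \<le> (SUP x\<in>signed_unit_sums B. blinfun_apply f x)"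
      unfolding x[symmetric] by (intro cSUP_upper)
  qed
qed

text \<open>The union is replaced by the disjoint sum \<open>Sigma UNIV B\<close>, whose
  unconditional sum may be computed fibre by fibre.\<close>

lemma infsum_disjoint_sums:
  fixes g :: "'a \<Rightarrow> real" and B :: "nat \<Rightarrow> 'a set"
  assumes "g summable_on UNIV" "disjoint_family B"
  shows "(\<lambda>n. infsum g (B n)) sums infsum g (\<Union>n. B n)"
proof (rule has_sum_imp_sums)
  have sub: "g summable_on A" for A
    using assms(1) by (rule summable_on_subset_banach) simp
  \<comment> \<open>A point of the union lies in only one \<open>B n\<close>, so it determines its
    index.\<close>
  have inj: "inj_on snd (Sigma UNIV B)"
    using assms(2) by (fastforce simp: inj_on_def disjoint_family_on_def)
  have "snd ` Sigma UNIV B = (\<Union>n. B n)"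
    by force
  then have "(g \<circ> snd has_sum infsum g (\<Union>n. B n)) (Sigma UNIV B)"
    using sub by (simp flip: has_sum_reindex[OF inj] add: has_sum_infsum)
  then show "((\<lambda>n. infsum g (B n)) has_sum infsum g (\<Union>n. B n)) UNIV"
    by (rule has_sum_SigmaD) (simp add: has_sum_infsum sub)
qed

text \<open>Along distinct singletons the values are the terms of a convergent series and tend to 0,
  so only finitely many exceed a given positive threshold.\<close>

lemma ca_countable_atoms:
  assumes "\<mu> \<in> ca \<Sigma>" "inj i" "\<And>\<alpha>. {i \<alpha>} \<in> \<Sigma>"
  shows "countable {\<alpha>. 0 < \<mu> {i \<alpha>}}"
proof -
  \<comment> \<open>\<open>Suc n\<close> keeps every threshold positive: \<open>inverse 0\<close> is
    0, and \<open>S 0\<close> would then contain all positive atoms.\<close>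
  define S where "S n = {\<alpha>. inverse (real (Suc n)) < \<mu> {i \<alpha>}}" for n
  have "finite (S n)" for n
  proof (rule ccontr)
    assume "infinite (S n)"
    then obtain h :: "nat \<Rightarrow> 'b" where h: "inj h" "range h \<subseteq> S n"
      by (meson infinite_countable_subset)
    have "disjoint_family (\<lambda>k. {i (h k)})"
      using h(1) assms(2) by (auto simp: disjoint_family_on_def dest!: injD)
    moreover have "range (\<lambda>k. {i (h k)}) \<subseteq> \<Sigma>"
      using assms(3) by blast
    ultimately have "(\<lambda>k. \<mu> {i (h k)}) sums \<mu> (\<Union>k. {i (h k)})"
      using assms(1) unfolding ca_def mem_Collect_eq by metis
    then have "(\<lambda>k. \<mu> {i (h k)}) \<longlonglongrightarrow> 0"
      by (meson sums_summable summable_LIMSEQ_zero)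
    moreover have "inverse (real (Suc n)) \<le> \<mu> {i (h k)}" for k
      using subsetD[OF h(2) rangeI[of h k]] by (simp add: S_def del: of_nat_Suc)
    ultimately have "inverse (real (Suc n)) \<le> 0"
      by (intro LIMSEQ_le_const) auto
    then show False
      by (simp add: field_simps)
  qed
  then have "countable (\<Union>n. S n)"
    by (simp add: countable_finite)
  moreover have "{\<alpha>. 0 < \<mu> {i \<alpha>}} \<subseteq> (\<Union>n. S n)"
    unfolding S_def using reals_Archimedean by auto
  ultimately show ?thesis
    using countable_subset by blast
qed

theorem mainTheorem4:
  fixes \<Omega> :: "'w set" and \<Sigma> :: "'w set set" and \<Omega>\<^sub>0 :: "'w set"
    and i :: "omega1 \<Rightarrow> 'w" and M :: "'w set \<Rightarrow> omega1 c0 set"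
  assumes "sigma_algebra \<Omega> \<Sigma>"
    and "\<Omega>\<^sub>0 \<subseteq> \<Omega>" and "uncountable \<Omega>\<^sub>0" and "\<And>t. t \<in> \<Omega>\<^sub>0 \<Longrightarrow> {t} \<in> \<Sigma>"
    and "inj i" and "range i \<subseteq> \<Omega>\<^sub>0"
    and "\<And>A. A \<in> \<Sigma> \<Longrightarrow> M A = {(\<Sum>\<alpha>\<in>F. c0_unit \<alpha>) - (\<Sum>\<alpha>\<in>G. c0_unit \<alpha>) | F G.
           F \<subseteq> i -` A \<and> G \<subseteq> i -` A \<and> finite F \<and> finite G \<and> F \<inter> G = {}}"
  shows "multimeasure \<Sigma> M \<and> \<not> (\<exists>\<mu>. control_measure \<Sigma> M \<mu>)"
proof
  \<comment> \<open>\<open>M\<close> is specified only on \<open>\<Sigma>\<close>, so each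
    rewriting, also at the union of a sequence, needs membership in \<open>\<Sigma>\<close>.\<close>
  have M: "M A = signed_unit_sums (i -` A)" if "A \<in> \<Sigma>" for A
    using assms(7)[OF that] by (simp add: signed_unit_sums_def)
  show "multimeasure \<Sigma> M"
    unfolding multimeasure_def ca_def
  proof (intro conjI allI CollectI impI)
    show "M \<in> \<Sigma> \<rightarrow> bdd_nonempty"
      by (simp add: M signed_unit_sums_bdd_nonempty)
  next
    fix f :: "omega1 c0 \<Rightarrow>\<^sub>L real" and A :: "nat \<Rightarrow> 'w set"
    assume A: "range A \<subseteq> \<Sigma>" "disjoint_family A"
    have "disjoint_family (\<lambda>n. i -` A n)"
      using A(2) by (auto simp: disjoint_family_on_def)
    from infsum_disjoint_sums[OF blinfun_c0_unit_abs_summable this]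
    have "(\<lambda>n. support_fun f (signed_unit_sums (i -` A n)))
        sums support_fun f (signed_unit_sums (i -` (\<Union>n. A n)))"
      by (simp add: support_fun_signed_unit_sums vimage_UN)
    moreover have "(\<Union>n. A n) \<in> \<Sigma>"
      using assms(1) A(1) by (rule sigma_algebra.countable_UN)
    moreover have "A n \<in> \<Sigma>" for n
      using A(1) by blast
    ultimately show "(\<lambda>n. support_fun f (M (A n))) sums support_fun f (M (\<Union>n. A n))"
      by (simp add: M)
  qed
  show "\<not> (\<exists>\<mu>. control_measure \<Sigma> M \<mu>)"
  proof
    assume "\<exists>\<mu>. control_measure \<Sigma> M \<mu>"
    then obtain \<mu> where "control_measure \<Sigma> M \<mu>" ..
    then have \<mu>: "\<mu> \<in> ca \<Sigma>" "\<And>A. A \<in> \<Sigma> \<Longrightarrow> 0 \<le> \<mu> A"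
      and null: "\<And>A. A \<in> \<Sigma> \<Longrightarrow> \<mu> A = 0 \<Longrightarrow> M A = {0}"
      by (auto simp: control_measure_def ca_plus_def)
    have i\<Sigma>: "{i \<alpha>} \<in> \<Sigma>" for \<alpha>
      using assms(4)[OF subsetD[OF assms(6) rangeI[of i \<alpha>]]] .
    \<comment> \<open>\<open>M {i \<alpha>}\<close> contains the nonzero vector
      \<open>c0_unit \<alpha>\<close>, so \<open>{i \<alpha>}\<close> cannot be null. All of
      \<open>omega1\<close> then indexes positive atoms.\<close>
    have "0 < \<mu> {i \<alpha>}" for \<alpha>
    proof -
      have "c0_unit \<alpha> \<in> M {i \<alpha>}"
        by (simp add: M[OF i\<Sigma>] c0_unit_in_signed_unit_sums)
      then have "\<mu> {i \<alpha>} \<noteq> 0"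
        using null[OF i\<Sigma>[of \<alpha>]] c0_unit_neq_0[of \<alpha>] by auto
      then show ?thesis
        using \<mu>(2)[OF i\<Sigma>] by (simp add: order_less_le)
    qed
    then have "countable (UNIV :: omega1 set)"
      using ca_countable_atoms[OF \<mu>(1) assms(5) i\<Sigma>] by simp
    then show False
      using uncountable_omega1 by contradiction
  qed
qed

end
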